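(* Let $d\geq 2$ be an integer, let $A$ be a finite set, let $\mathbb{F}$ be a field, and let $T:A^{d}\rightarrow\mathbb{F}$ be a $d$-dimensional semi-diagonal tensor. Then $$\operatorname{mfrank}(T)\geq \frac{|A|}{d-1}.$$
   Context: A $d$-dimensional tensor over a field $\mathbb{F}$ is a function $T:A_1\times\dots\times A_d\rightarrow\mathbb{F}$, where $A_1,\dots,A_d$ are finite sets. For $i\in[d]=\{1,\dots,d\}$, the $i$-flattening rank $\operatorname{frank}_i(T)$ is the rank over $\mathbb{F}$ of the matrix whose rows are indexed by $A_i$, whose columns are indexed by $B_i=A_1\times\dots\times A_{i-1}\times A_{i+1}\times\dots\times A_d$, and whose entry in row $a_i$ and column $(a_1,\dots,a_{i-1},a_{i+1},\dots,a_d)$ is $T(a_1,\dots,a_d)$. The max-flattening rank is $\operatorname{mfrank}(T)=\max_{i\in[d]}\operatorname{frank}_i(T)$. A tensor $T:A^d\rightarrow\mathbb{F}$ is semi-diagonal if $T(a_1,\dots,a_d)=0$ whenever $a_1,\dots,a_d\in A$ are all (pairwise) distinct, and $T(a,\dots,a)\neq 0$ for every $a\in A$. There is no restriction on the value $T(a_1,\dots,a_d)$ when $a_1,\dots,a_d$ are neither all equal nor all distinct. *)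

theory Defs
  imports Complex_Main "HOL-Library.FuncSet" "HOL-Library.Function_Algebras"
begin

global_interpretation fun_vs: vector_space "\<lambda>(k::'f::field) (v::'c \<Rightarrow> 'f) x. k * v x"
  by unfold_locales (auto simp: fun_eq_iff algebra_simps)

text \<open>
  The rank of a matrix with row index set \<open>R\<close> and column index set \<open>C\<close> is the dimension of
  the span of its rows. A row is a vector in \<open>F\<^sup>C\<close>, represented as a function that is
  zero outside \<open>C\<close>.
\<close>

definition matrix_row :: "'c set \<Rightarrow> ('r \<Rightarrow> 'c \<Rightarrow> 'f::field) \<Rightarrow> 'r \<Rightarrow> 'c \<Rightarrow> 'f" where
  "matrix_row C M r = (\<lambda>c. if c \<in> C then M r c else 0)"

definition matrix_rank :: "'r set \<Rightarrow> 'c set \<Rightarrow> ('r \<Rightarrow> 'c \<Rightarrow> 'f::field) \<Rightarrow> nat" where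
  "matrix_rank R C M = fun_vs.dim (fun_vs.span (matrix_row C M ` R))"

text \<open>
  A \<open>d\<close>-dimensional tensor on \<open>A 1 \<times> \<dots> \<times> A d\<close> is a function on \<open>PiE {1..d} A\<close>; values
  elsewhere are never inspected. A column of the \<open>i\<close>-flattening is a family
  \<open>b \<in> PiE ({1..d} - {i}) A\<close>, which the row index \<open>x \<in> A i\<close> completes to the
  point \<open>b(i := x)\<close>.
\<close>

definition frank :: "nat \<Rightarrow> (nat \<Rightarrow> 'a set) \<Rightarrow> ((nat \<Rightarrow> 'a) \<Rightarrow> 'f::field) \<Rightarrow> nat \<Rightarrow> nat" where
  "frank d A T i = matrix_rank (A i) (PiE ({1..d} - {i}) A) (\<lambda>x b. T (b(i := x)))"

definition mfrank :: "nat \<Rightarrow> (nat \<Rightarrow> 'a set) \<Rightarrow> ((nat \<Rightarrow> 'a) \<Rightarrow> 'f::field) \<Rightarrow> nat" where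
  "mfrank d A T = Max (frank d A T ` {1..d})"

definition semi_diagonal :: "nat \<Rightarrow> 'a set \<Rightarrow> ((nat \<Rightarrow> 'a) \<Rightarrow> 'f::field) \<Rightarrow> bool" where
  "semi_diagonal d A T \<longleftrightarrow>
     (\<forall>a \<in> PiE {1..d} (\<lambda>_. A). inj_on a {1..d} \<longrightarrow> T a = 0) \<and>
     (\<forall>x \<in> A. T (\<lambda>i\<in>{1..d}. x) \<noteq> 0)"

end

theory Submission
  imports Defs
begin

text \<open>
  Each flattening gives a way to move a nonzero entry of \<open>T\<close>: if the \<open>i\<close>-th slice at \<open>a\<close> is a
  linear combination of the slices at the elements of a set \<open>S\<close> and \<open>T p \<noteq> 0\<close> with \<open>p i = a\<close>,
  then some \<open>b \<in> S\<close> has \<open>T (p(i := b)) \<noteq> 0\<close>. The proof applies this to a diagonal entry, one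
  coordinate at a time, and makes the new coordinates distinct.

  Choose pairwise disjoint sets \<open>S\<^sub>1, \<dots>, S\<^sub>d\<^sub>-\<^sub>1 \<subseteq> A\<close> greedily: \<open>S\<^sub>i\<close> indexes a basis of the row
  space of the \<open>i\<close>-flattening restricted to the rows outside \<open>S\<^sub>1 \<union> \<dots> \<union> S\<^sub>i\<^sub>-\<^sub>1\<close>, so that it has
  at most \<open>frank\<^sub>i(T) \<le> mfrank(T)\<close> elements. If the union of these \<open>d - 1\<close> sets missed some
  \<open>a \<in> A\<close>, then \<open>a\<close> would be a row of every restricted flattening. Starting from
  \<open>T(a, \<dots>, a) \<noteq> 0\<close>, coordinate after coordinate could then be exchanged for an element of
  \<open>S\<^sub>i\<close>, to end at \<open>T(b\<^sub>1, \<dots>, b\<^sub>d\<^sub>-\<^sub>1, a) \<noteq> 0\<close> with all arguments distinct, which a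
  semi-diagonal tensor forbids. Hence \<open>card A \<le> (d - 1) * mfrank(T)\<close>.
  The greedy step is \<open>row_basis_indices\<close>, and \<open>exchange_coordinates\<close> iterates the exchange.
\<close>

lemma span_nonzero_entry:
  fixes S :: "('c \<Rightarrow> 'f::field) set"
  assumes "v \<in> fun_vs.span S" and "v c \<noteq> 0"
  shows "\<exists>s\<in>S. s c \<noteq> 0"
proof (rule ccontr)
  assume zero: "\<not> ?thesis"
  from assms(1) have "v c = 0"
    by (induction rule: fun_vs.span_induct_alt) (use zero in auto)
  with assms(2) show False by simp
qed

text \<open>
  The ambient space of all functions need not be finite-dimensional, so the independent set is
  extended to a basis of the finitely generated subspace itself.
\<close>

lemma independent_card_le_dim_span:
  fixes V W :: "('c \<Rightarrow> 'f::field) set"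
  assumes "fun_vs.independent V" and "V \<subseteq> fun_vs.span W" and "finite W"
  shows "card V \<le> fun_vs.dim (fun_vs.span W)"
proof -
  obtain B where B: "V \<subseteq> B" "B \<subseteq> fun_vs.span W" "fun_vs.independent B"
      "fun_vs.span W \<subseteq> fun_vs.span B"
    using fun_vs.maximal_independent_subset_extend[OF assms(2,1)] by blast
  have "finite B"
    using fun_vs.independent_span_bound[OF assms(3) B(3,2)] by blast
  then have "card V \<le> card B"
    using B(1) by (rule card_mono)
  also have "card B = fun_vs.dim (fun_vs.span W)"
    using fun_vs.basis_card_eq_dim[OF B(2) B(4) B(3)] by simp
  finally show ?thesis .
qed

text \<open>
  The rows of \<open>R'\<close> span a subspace of the full row space, so a basis chosen among them is no
  larger than the rank of the full matrix. Since that basis spans every row of \<open>R'\<close>, in each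
  column where such a row is nonzero some basis row is nonzero as well.
\<close>

lemma row_basis_indices:
  fixes M :: "'r \<Rightarrow> 'c \<Rightarrow> 'f::field"
  assumes "finite R" and "R' \<subseteq> R"
  obtains S where "S \<subseteq> R'" and "card S \<le> matrix_rank R C M"
    and "\<And>r c. r \<in> R' \<Longrightarrow> c \<in> C \<Longrightarrow> M r c \<noteq> 0 \<Longrightarrow> \<exists>s\<in>S. M s c \<noteq> 0"
proof -
  let ?row = "matrix_row C M"
  obtain V where V: "V \<subseteq> ?row ` R'" "fun_vs.independent V" "?row ` R' \<subseteq> fun_vs.span V"
    using fun_vs.maximal_independent_subset[of "?row ` R'"] by blast
  obtain S where S: "S \<subseteq> R'" "inj_on ?row S" "V = ?row ` S"
    using V(1) by (auto simp: subset_image_inj)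
  have "V \<subseteq> ?row ` R"
    using V(1) assms(2) by blast
  then have "V \<subseteq> fun_vs.span (?row ` R)"
    using fun_vs.span_superset by blast
  then have "card V \<le> matrix_rank R C M"
    unfolding matrix_rank_def
    using V(2) assms(1) by (intro independent_card_le_dim_span) auto
  then have card: "card S \<le> matrix_rank R C M"
    using S by (simp add: card_image)
  have "\<exists>s\<in>S. M s c \<noteq> 0" if "r \<in> R'" "c \<in> C" "M r c \<noteq> 0" for r c
  proof -
    have "?row r \<in> fun_vs.span V"
      using V(3) that(1) by blast
    moreover have "?row r c \<noteq> 0"
      using that(2,3) by (simp add: matrix_row_def)
    ultimately have "\<exists>v\<in>V. v c \<noteq> 0"
      by (rule span_nonzero_entry)
    then show ?thesis
      using S(3) that(2) by (auto simp: matrix_row_def)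
  qed
  with S(1) card show thesis by (rule that)
qed

text \<open>
  The set \<open>B\<close> is the union of the first \<open>k\<close> greedily chosen bases. Choosing every new basis outside
  \<open>B\<close> keeps the exchanged coordinates distinct. It still serves all \<open>a\<close> that lie outside the
  enlarged set, because these were outside \<open>B\<close> already. The point \<open>p\<close> depends on \<open>a\<close>, but
  \<open>B\<close> does not.
\<close>

lemma exchange_coordinates:
  fixes A :: "'a set" and T :: "(nat \<Rightarrow> 'a) \<Rightarrow> 'f::field"
  assumes "finite A" and diag: "\<And>x. x \<in> A \<Longrightarrow> T (\<lambda>i\<in>{1..d}. x) \<noteq> 0" and "k \<le> d"
  shows "\<exists>B\<subseteq>A. card B \<le> (\<Sum>i=1..k. frank d (\<lambda>_. A) T i) \<and>
    (\<forall>a\<in>A - B. \<exists>p\<in>PiE {1..d} (\<lambda>_. A). T p \<noteq> 0 \<and> p ` {1..k} \<subseteq> B \<and> inj_on p {1..k} \<and>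
       (\<forall>i\<in>{k<..d}. p i = a))"
  using assms(3)
proof (induction k)
  case 0
  have "\<exists>p\<in>PiE {1..d} (\<lambda>_. A). T p \<noteq> 0 \<and> p ` {1..0::nat} \<subseteq> {} \<and> inj_on p {1..0::nat} \<and>
      (\<forall>i\<in>{0<..d}. p i = a)" if "a \<in> A - {}" for a
    using diag[of a] that by (intro bexI[of _ "\<lambda>i\<in>{1..d}. a"]) auto
  then show ?case
    by (intro exI[of _ "{}"]) simp
next
  case (Suc k)
  let ?j = "Suc k" and ?f = "\<lambda>i. frank d (\<lambda>_. A) T i"
  obtain B where B: "B \<subseteq> A" "card B \<le> (\<Sum>i=1..k. ?f i)"
    and point: "\<And>a. a \<in> A - B \<Longrightarrow> \<exists>p\<in>PiE {1..d} (\<lambda>_. A). T p \<noteq> 0 \<and> p ` {1..k} \<subseteq> B \<and>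
       inj_on p {1..k} \<and> (\<forall>i\<in>{k<..d}. p i = a)"
    using Suc by auto
  obtain S where S: "S \<subseteq> A - B" "card S \<le> ?f ?j"
    and exchange: "\<And>a c. a \<in> A - B \<Longrightarrow> c \<in> PiE ({1..d} - {?j}) (\<lambda>_. A) \<Longrightarrow> T (c(?j := a)) \<noteq> 0
       \<Longrightarrow> \<exists>s\<in>S. T (c(?j := s)) \<noteq> 0"
    unfolding frank_def
    using row_basis_indices[of A "A - B" "PiE ({1..d} - {?j}) (\<lambda>_. A)" "\<lambda>x b. T (b(?j := x))"]
      assms(1) by blast
  have "card (B \<union> S) \<le> (\<Sum>i=1..?j. ?f i)"
    using card_Un_le[of B S] B(2) S(2) by simp
  moreover have "\<exists>p\<in>PiE {1..d} (\<lambda>_. A). T p \<noteq> 0 \<and> p ` {1..?j} \<subseteq> B \<union> S \<and>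
      inj_on p {1..?j} \<and> (\<forall>i\<in>{?j<..d}. p i = a)" if a: "a \<in> A - (B \<union> S)" for a
  proof -
    obtain p where p: "p \<in> PiE {1..d} (\<lambda>_. A)" "T p \<noteq> 0" "p ` {1..k} \<subseteq> B"
        "inj_on p {1..k}" "\<forall>i\<in>{k<..d}. p i = a"
      using point a by blast
    \<comment> \<open>Forgetting coordinate \<open>k + 1\<close> of \<open>p\<close> gives a column of that flattening; \<open>p\<close> is its
      completion by the row index \<open>a\<close>.\<close>
    let ?c = "p(?j := undefined)"
    have "?c \<in> PiE ({1..d} - {?j}) (\<lambda>_. A)"
      using p(1) by (auto simp: PiE_iff extensional_def)
    moreover have "p ?j = a"
      using p(5) Suc.prems by simp
    then have "?c(?j := a) = p"
      by auto
    ultimately obtain s where s: "s \<in> S" "T (p(?j := s)) \<noteq> 0"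
      using exchange[of a ?c] a p(2) by auto
    have "p(?j := s) \<in> PiE {1..d} (\<lambda>_. A)"
      using p(1) s(1) S(1) Suc.prems by (auto simp: PiE_iff extensional_def)
    moreover have "p(?j := s) ` {1..?j} \<subseteq> B \<union> S"
      using p(3) s(1) by (auto simp: atLeastAtMostSuc_conv)
    moreover have "inj_on (p(?j := s)) {1..?j}"
    proof -
      have "s \<notin> p ` {1..k}"
        using p(3) s(1) S(1) by blast
      moreover have "p(?j := s) ` {1..k} = p ` {1..k}"
        by (intro image_cong) auto
      moreover have "inj_on (p(?j := s)) {1..k}"
        using p(4) by (subst inj_on_cong[of _ _ p]) auto
      ultimately show ?thesis
        by (simp add: atLeastAtMostSuc_conv)
    qed
    moreover have "\<forall>i\<in>{?j<..d}. (p(?j := s)) i = a"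
      using p(5) by auto
    ultimately show ?thesis
      using s(2) by blast
  qed
  moreover have "B \<union> S \<subseteq> A"
    using B(1) S(1) by blast
  ultimately show ?case
    by (intro exI[of _ "B \<union> S"] conjI ballI)
qed

theorem theorem1:
  fixes d :: nat and A :: "'a set" and T :: "(nat \<Rightarrow> 'a) \<Rightarrow> 'f::field"
  assumes "d \<ge> 2"
    and "finite A"
    and "semi_diagonal d A T"
  shows "real (mfrank d (\<lambda>_. A) T) \<ge> real (card A) / (real d - 1)"
proof -
  let ?m = "mfrank d (\<lambda>_. A) T"
  have diag: "T (\<lambda>i\<in>{1..d}. x) \<noteq> 0" if "x \<in> A" for x
    using assms(3) that by (simp add: semi_diagonal_def)
  obtain B where B: "B \<subseteq> A" "card B \<le> (\<Sum>i=1..d-1. frank d (\<lambda>_. A) T i)"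
    and point: "\<And>a. a \<in> A - B \<Longrightarrow> \<exists>p\<in>PiE {1..d} (\<lambda>_. A). T p \<noteq> 0 \<and> p ` {1..d-1} \<subseteq> B \<and>
       inj_on p {1..d-1} \<and> (\<forall>i\<in>{d-1<..d}. p i = a)"
    using exchange_coordinates[where d = d and T = T and k = "d - 1", OF assms(2) diag] by auto
  have "A \<subseteq> B"
  proof (rule ccontr)
    assume "\<not> A \<subseteq> B"
    then obtain a where a: "a \<in> A - B" by blast
    then obtain p where p: "p \<in> PiE {1..d} (\<lambda>_. A)" "T p \<noteq> 0" "p ` {1..d-1} \<subseteq> B"
        "inj_on p {1..d-1}" "\<forall>i\<in>{d-1<..d}. p i = a"
      using point by blast
    have "p d \<notin> p ` {1..d-1}"
      using p(3,5) a assms(1) by auto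
    moreover have "{1..d} = insert d {1..d-1}"
      using assms(1) by auto
    ultimately have "inj_on p {1..d}"
      using p(4) by (simp, blast)
    then show False
      using assms(3) p(1,2) by (simp add: semi_diagonal_def)
  qed
  then have "card A \<le> (\<Sum>i=1..d-1. frank d (\<lambda>_. A) T i)"
    using B by (metis subset_antisym)
  also have "\<dots> \<le> (\<Sum>i=1..d-1. ?m)"
    unfolding mfrank_def by (intro sum_mono Max_ge) auto
  finally have "card A \<le> (d - 1) * ?m"
    by simp
  then have "real (card A) \<le> real ((d - 1) * ?m)"
    by (simp only: of_nat_le_iff)
  then show ?thesis
    using assms(1) by (simp add: of_nat_diff divide_le_eq mult.commute)
qed

end
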